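(* Let $\pi$ be a permutation having label $(k,m_\ell)$, different from an identity permutation. Then the number of leaves of the tree $T(\pi)$ is $$L(k,m_\ell)=\sum_{j=1}^{m_\ell-1}j!\,j\,(j+1)^{k-j-1}+m_\ell!\,(m_\ell+1)^{k-m_\ell}.$$ Moreover, each summand records the contribution of each level of $T(\pi)$: denoting by $L_j(k,m_\ell)$ the number of leaves (of $T(\pi)$) at height $j$ in $T(\pi)$, we have $L_j(k,m_\ell)=j!\,j\,(j+1)^{k-j-1}$ for $j<m_\ell$, and $L_{m_\ell}(k,m_\ell)=m_\ell!\,(m_\ell+1)^{k-m_\ell}$.
   Context: $S_n$ is the set of permutations $\pi=\pi_1\dots\pi_n$ of $\{1,\dots,n\}$ and $id_n=12\dots n$. An element $\pi_j$ is a left-to-right maximum of $\pi$ if $\pi_j>\pi_i$ for all $i<j$. The bubblesort operator $\mathbf{B}$ is one pass of the bubblesort algorithm: scan the positions from left to right, each time exchanging the current element with the one to its right whenever the latter is smaller. Equivalently, writing $\pi=\mu_1A_1\mu_2A_2\dots\mu_kA_k$ where the $\mu_i$ are all the left-to-right maxima of $\pi$ (and the $A_i$ are possibly empty sequences), $\mathbf{B}(\pi)=A_1\mu_1A_2\mu_2\dots A_k\mu_k$. $T_n$ is the rooted tree whose nodes are the permutations in $S_n$, with root $id_n$, in which $\tau$ is a child of $\sigma$ if and only if $\mathbf{B}(\tau)=\sigma$ and $\sigma\ne\tau$. For $\pi\in S_n$, $T(\pi)$ is the subtree of $T_n$ rooted at $\pi$ (consisting of $\pi$ and all its descendants). A leaf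 is a node without children (if $T(\pi)$ is a single node, that node is a leaf). The height of a node in a rooted tree is the number of edges on the path connecting it to the root of that tree. Empty sums are $0$. The label of a permutation $\pi$ is the pair $(k,m_\ell)$ where $k$ is the number of left-to-right maxima of $\pi$ and $m_\ell\ge 0$ is the length of the longest suffix of $\pi$ all of whose elements are left-to-right maxima of $\pi$ (the symbol $m_\ell$ is just a name for this integer). *)

theory Defs
  imports "HOL-Combinatorics.Multiset_Permutations" "HOL-Library.Sublist"
begin

text \<open>Permutations are in one-line notation: the elements of \<open>S\<^sub>n\<close> are the lists in
  \<open>permutations_of_set {1..n}\<close>.\<close>

abbreviation S :: "nat \<Rightarrow> nat list set" where
  "S n \<equiv> permutations_of_set {1..n}"

definition id_perm :: "nat \<Rightarrow> nat list" where
  "id_perm n = [1..<Suc n]"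

fun bubble :: "nat list \<Rightarrow> nat list" where
  "bubble [] = []"
| "bubble [x] = [x]"
| "bubble (x # y # xs) = (if y < x then y # bubble (x # xs) else x # bubble (y # xs))"

definition ltr_maxima :: "nat list \<Rightarrow> nat set" where
  "ltr_maxima p = {p ! j | j. j < length p \<and> (\<forall>i<j. p ! i < p ! j)}"

definition label :: "nat list \<Rightarrow> nat \<times> nat" where
  "label p = (card (ltr_maxima p), Max {length s | s. suffix s p \<and> set s \<subseteq> ltr_maxima p})"

text \<open>The tree \<open>T\<^sub>n\<close> is given by its edges, directed from parent to child.\<close>

definition tree_edges :: "nat \<Rightarrow> (nat list \<times> nat list) set" where
  "tree_edges n = {(\<sigma>, \<tau>). \<sigma> \<in> S n \<and> \<tau> \<in> S n \<and> bubble \<tau> = \<sigma> \<and> \<sigma> \<noteq> \<tau>}"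

definition subtree_nodes :: "nat \<Rightarrow> nat list \<Rightarrow> nat list set" where
  "subtree_nodes n p = (tree_edges n)\<^sup>* `` {p}"

definition subtree_edges :: "nat \<Rightarrow> nat list \<Rightarrow> (nat list \<times> nat list) set" where
  "subtree_edges n p = tree_edges n \<inter> (subtree_nodes n p \<times> subtree_nodes n p)"

definition subtree_leaves :: "nat \<Rightarrow> nat list \<Rightarrow> nat list set" where
  "subtree_leaves n p = {\<tau> \<in> subtree_nodes n p. \<nexists>\<rho>. (\<tau>, \<rho>) \<in> subtree_edges n p}"

text \<open>Length of the path from the root \<open>p\<close> to \<open>\<tau>\<close>. Following edges backwards amounts to
  iterating \<^const>\<open>bubble\<close>, so this length is unique whenever \<open>\<tau>\<close> is a node of the
  subtree (and \<open>THE\<close> is meaningful only for those \<open>\<tau>\<close>).\<close>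

definition subtree_height :: "nat \<Rightarrow> nat list \<Rightarrow> nat list \<Rightarrow> nat" where
  "subtree_height n p \<tau> = (THE h. (p, \<tau>) \<in> subtree_edges n p ^^ h)"

end

theory Submission
  imports Defs
begin

text \<open>Encode a permutation \<open>\<pi>\<close> by the word \<open>c\<close> whose entry \<open>c\<^sub>j\<close> counts the larger elements to
  the left of position \<open>j\<close>. This is a bijection from \<open>S\<^sub>n\<close> onto the words with \<open>c\<^sub>j < j\<close>
  (\<open>1 \<le> j \<le> n\<close>), it turns left-to-right maxima into zeros, and it conjugates \<open>\<^bold>B\<close> into deleting
  the first entry, decreasing the others (truncated at \<open>0\<close>) and appending \<open>0\<close>. Hence a word \<open>d\<close>
  lies \<open>h\<close> levels below \<open>c\<close> iff \<open>c\<close> ends with \<open>h\<close> zeros and \<open>d\<^sub>j\<^sub>+\<^sub>h = c\<^sub>j + h\<close> or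
  \<open>d\<^sub>j\<^sub>+\<^sub>h \<le> h\<close> according to whether \<open>c\<^sub>j > 0\<close> or \<open>c\<^sub>j = 0\<close>, the first \<open>h\<close> entries being free,
  and \<open>d\<close> is a leaf iff its last entry is nonzero. The numbers of leaves are then products of
  numbers of independent choices.\<close>

section \<open>Words with independent entries, and the inversion code as a bijection\<close>

lemma card_lists_nth_mem:
  assumes "\<And>i. i < n \<Longrightarrow> finite (F i)"
  shows "card {xs. length xs = n \<and> (\<forall>i<n. xs ! i \<in> F i)} = (\<Prod>i<n. card (F i))"
  using assms
proof (induction n)
  case 0
  have "{xs :: 'a list. length xs = 0 \<and> (\<forall>i<0. xs ! i \<in> F i)} = {[]}" by auto
  then show ?case by simp
next
  case (Suc n)
  let ?A = "{xs. length xs = n \<and> (\<forall>i<n. xs ! i \<in> F i)}"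
  have "{xs. length xs = Suc n \<and> (\<forall>i<Suc n. xs ! i \<in> F i)} = (\<lambda>(xs, x). xs @ [x]) ` (?A \<times> F n)"
    (is "?L = ?R")
  proof (intro set_eqI iffI)
    fix xs assume xs: "xs \<in> ?L"
    then obtain ys y where ys: "xs = ys @ [y]" "length ys = n"
      by (auto simp: length_Suc_conv_rev)
    have "ys ! i \<in> F i" if "i < n" for i
      using xs ys that by (auto simp: nth_append dest: spec[of _ i])
    moreover have "y \<in> F n" using xs ys by (auto simp: nth_append dest: spec[of _ n])
    ultimately show "xs \<in> ?R" using ys by auto
  qed (auto simp: nth_append less_Suc_eq)
  moreover have "inj_on (\<lambda>(xs, x). xs @ [x]) (?A \<times> F n)"
    by (auto simp: inj_on_def)
  ultimately show ?case
    using Suc by (simp add: card_image card_cartesian_product mult.commute)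
qed

text \<open>The set \<open>P\<close> collects the elements preceding the list.\<close>

fun inv_code :: "'a::linorder set \<Rightarrow> 'a list \<Rightarrow> nat list" where
  "inv_code P [] = []"
| "inv_code P (x # xs) = card {y \<in> P. x < y} # inv_code (insert x P) xs"

lemma length_inv_code [simp]: "length (inv_code P xs) = length xs"
  by (induction P xs rule: inv_code.induct) auto

lemma inv_code_nth:
  "j < length xs \<Longrightarrow> inv_code P xs ! j = card {y \<in> P \<union> set (take j xs). xs ! j < y}"
proof (induction P xs arbitrary: j rule: inv_code.induct)
  case (2 P x xs)
  then show ?case by (cases j) auto
qed auto

text \<open>The defining recursion reads from the left; injectivity needs it from the right, where
  the last element is compared with all others.\<close>

lemma inv_code_snoc:
  "inv_code P (xs @ [x]) = inv_code P xs @ [card {y \<in> P \<union> set xs. x < y}]"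
  by (induction P xs rule: inv_code.induct) auto

lemma inv_code_nth_le:
  assumes "j < length xs"
  shows "inv_code {} xs ! j \<le> j"
proof -
  have "inv_code {} xs ! j \<le> card (set (take j xs))"
    using assms by (auto simp: inv_code_nth intro!: card_mono)
  also have "\<dots> \<le> j" using card_length[of "take j xs"] by simp
  finally show ?thesis .
qed

lemma inv_code_nth_eq_0_iff:
  assumes "j < length xs" "distinct xs"
  shows "inv_code {} xs ! j = 0 \<longleftrightarrow> (\<forall>i<j. xs ! i < xs ! j)"
proof -
  have "inv_code {} xs ! j = 0 \<longleftrightarrow> (\<forall>y \<in> set (take j xs). \<not> xs ! j < y)"
    using assms by (auto simp: inv_code_nth)
  also have "\<dots> \<longleftrightarrow> (\<forall>i<j. \<not> xs ! j < xs ! i)"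
    using assms by (auto simp: set_conv_nth)
  also have "\<dots> \<longleftrightarrow> (\<forall>i<j. xs ! i < xs ! j)"
    using assms by (metis less_trans nat_neq_iff not_less_iff_gr_or_eq nth_eq_iff_index_eq)
  finally show ?thesis .
qed

text \<open>In a finite linear order the number of larger elements strictly decreases as the element
  grows.\<close>

lemma card_greater_inj:
  fixes x y :: "'a::linorder"
  assumes "finite A" "x \<in> A" "y \<in> A" "card {z \<in> A. x < z} = card {z \<in> A. y < z}"
  shows "x = y"
proof -
  have *: "card {z \<in> A. v < z} < card {z \<in> A. u < z}" if "u < v" "v \<in> A" for u v
    using assms(1) that by (intro psubset_card_mono) auto
  from *[of x y] *[of y x] assms show ?thesis by (cases x y rule: linorder_cases) auto
qed

text \<open>The last entry is the number of larger elements in the whole set, so it determines the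
  last element. Removing that element leaves a shorter instance.\<close>

lemma inv_code_inj:
  assumes "distinct xs" "distinct ys" "set xs = set ys" "inv_code {} xs = inv_code {} ys"
  shows "xs = ys"
  using assms
proof (induction xs arbitrary: ys rule: rev_induct)
  case (snoc x xs)
  then obtain y ys' where ys: "ys = ys' @ [y]"
    by (metis append_is_Nil_conv empty_set not_Cons_self2 rev_exhaust set_empty)
  have set_eq: "insert x (set xs) = insert y (set ys')" using snoc.prems ys by simp
  \<comment> \<open>No element exceeds itself, so both last entries can be read as counts in the
    common set \<open>insert x (set xs)\<close>.\<close>
  have greater: "{z \<in> set zs. u < z} = {z \<in> insert u (set zs). u < z}" for u :: 'a and zs
    by auto
  have "card {z \<in> set xs. x < z} = card {z \<in> set ys'. y < z}"
    using snoc.prems ys by (simp add: inv_code_snoc)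
  then have "x = y"
    using set_eq by (intro card_greater_inj[of "insert x (set xs)"]) (auto simp: greater)
  moreover have "set xs = set ys'"
    using set_eq snoc.prems ys \<open>x = y\<close> by (auto simp: insert_eq_iff)
  moreover have "inv_code {} xs = inv_code {} ys'"
    using snoc.prems ys by (simp add: inv_code_snoc)
  ultimately show ?case using snoc.IH[of ys'] snoc.prems ys by simp
qed auto

lemma S_length: "p \<in> S n \<Longrightarrow> length p = n"
  by (drule length_finite_permutations_of_set) simp

text \<open>No inverse is constructed: an injection into a set that also has \<open>fact n\<close>
  elements is onto. Positions start at 0, hence the bound \<open>c ! i \<le> i\<close>.\<close>

lemma inv_code_bij_betw:
  "bij_betw (inv_code {}) (S n) {c. length c = n \<and> (\<forall>i<n. c ! i \<in> {..i})}"
proof -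
  let ?E = "{c :: nat list. length c = n \<and> (\<forall>i<n. c ! i \<in> {..i})}"
  have card: "card ?E = fact n"
    by (subst card_lists_nth_mem) (simp_all add: fact_prod_Suc atLeast0LessThan)
  have inj: "inj_on (inv_code {}) (S n)"
    by (auto simp: inj_on_def permutations_of_set_def intro!: inv_code_inj)
  have "inv_code {} p ! i \<le> i" if "p \<in> S n" "i < n" for p i
    using that by (intro inv_code_nth_le) (simp only: S_length)
  then have "inv_code {} ` S n \<subseteq> ?E" by (auto simp: S_length)
  moreover have "finite ?E" by (rule card_ge_0_finite) (simp only: card fact_gt_zero)
  ultimately have "inv_code {} ` S n = ?E"
    by (intro card_subset_eq) (simp_all only: card card_image[OF inj] card_permutations_of_set
        finite_atLeastAtMost card_atLeastAtMost diff_Suc_1)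
  with inj show ?thesis by (simp add: bij_betw_def)
qed

section \<open>Bubblesort acting on codes\<close>

lemma mset_bubble [simp]: "mset (bubble xs) = mset xs"
  by (induction xs rule: bubble.induct) auto

lemma bubble_in_permutations_of_set_iff [simp]:
  "bubble p \<in> permutations_of_set A \<longleftrightarrow> p \<in> permutations_of_set A"
  using mset_eq_setD[OF mset_bubble, of p] mset_eq_imp_distinct_iff[OF mset_bubble, of p]
  by (simp add: permutations_of_set_def)

text \<open>The element carried along by the bubblesort pass is the maximum of those seen so far.\<close>

lemma inv_code_bubble_Cons:
  assumes "finite P" "\<And>z. z \<in> P \<Longrightarrow> z < x" "distinct (x # xs)" "P \<inter> set xs = {}"
  shows "inv_code P (bubble (x # xs)) = map (\<lambda>c. c - 1) (inv_code (insert x P) xs) @ [0]"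
  using assms
proof (induction xs arbitrary: x P)
  case Nil
  then show ?case by (auto dest: order.asym)
next
  case (Cons y ys)
  show ?case
  proof (cases "y < x")
    case True
    \<comment> \<open>Here \<open>y\<close> moves in front of the carried \<open>x\<close>, so
      exactly one larger element leaves its count.\<close>
    have "{z \<in> insert x P. y < z} = insert x {z \<in> P. y < z}" using True by auto
    moreover have "x \<notin> P" using Cons.prems by blast
    ultimately have "card {z \<in> insert x P. y < z} - 1 = card {z \<in> P. y < z}"
      using Cons.prems by simp
    moreover have "inv_code (insert y P) (bubble (x # ys))
        = map (\<lambda>c. c - 1) (inv_code (insert x (insert y P)) ys) @ [0]"
      using Cons.prems True by (intro Cons.IH) auto
    ultimately show ?thesis using True by (simp add: insert_commute)
  next
    case False
    then have xy: "x < y" using Cons.prems by auto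
    \<comment> \<open>Now \<open>x\<close> is put down and \<open>y\<close> is carried on. Both
      counts are 0, so the entry emitted for \<open>x\<close> is the truncated decrement of the
      entry of \<open>y\<close>.\<close>
    have 0: "{z \<in> insert x P. y < z} = {}" "{z \<in> P. x < z} = {}"
      using Cons.prems(2) xy by (auto dest: order.asym less_trans)
    have "inv_code (insert x P) (bubble (y # ys))
        = map (\<lambda>c. c - 1) (inv_code (insert y (insert x P)) ys) @ [0]"
      using Cons.prems xy by (intro Cons.IH) (auto dest: less_trans)
    moreover have "inv_code P (bubble (x # y # ys)) = 0 # inv_code (insert x P) (bubble (y # ys))"
      using False by (simp add: 0)
    moreover have "inv_code (insert x P) (y # ys) = 0 # inv_code (insert y (insert x P)) ys"
      by (simp only: inv_code.simps 0 card.empty)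
    ultimately show ?thesis by simp
  qed
qed

lemma inv_code_bubble:
  assumes "distinct p" "p \<noteq> []"
  shows "inv_code {} (bubble p) = map (\<lambda>c. c - 1) (tl (inv_code {} p)) @ [0]"
  using assms inv_code_bubble_Cons[of "{}"] by (cases p) auto

lemma inv_code_bubble_nth:
  assumes "distinct p" "i < length p"
  shows "inv_code {} (bubble p) ! i
    = (if Suc i < length p then inv_code {} p ! Suc i - 1 else 0)"
  using assms by (subst inv_code_bubble) (auto simp: nth_append nth_tl)

lemma bubble_funpow_in_permutations_of_set_iff [simp]:
  "(bubble ^^ h) p \<in> permutations_of_set A \<longleftrightarrow> p \<in> permutations_of_set A"
  by (induction h) auto

lemma S_distinct: "p \<in> S n \<Longrightarrow> distinct p"
  by (rule permutations_of_setD)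

text \<open>Truncated decrements compose, and appended zeros stay zero while they move left. In
  particular, \<open>n\<close> passes erase the whole code.\<close>

lemma inv_code_bubble_funpow_nth:
  assumes "p \<in> S n" "i < n"
  shows "inv_code {} ((bubble ^^ h) p) ! i = (if i + h < n then inv_code {} p ! (i + h) - h else 0)"
  using assms(2)
proof (induction h arbitrary: i)
  case (Suc h)
  have "(bubble ^^ h) p \<in> S n" using assms(1) by simp
  then have "length ((bubble ^^ h) p) = n" "distinct ((bubble ^^ h) p)"
    by (rule S_length, rule S_distinct)
  then have "inv_code {} ((bubble ^^ Suc h) p) ! i
      = (if Suc i < n then inv_code {} ((bubble ^^ h) p) ! Suc i - 1 else 0)"
    using Suc.prems by (simp add: inv_code_bubble_nth)
  then show ?case using Suc.IH[of "Suc i"] by simp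
qed simp

lemma inv_code_eqI:
  assumes "p \<in> S n" "q \<in> S n" "\<And>i. i < n \<Longrightarrow> inv_code {} p ! i = inv_code {} q ! i"
  shows "p = q"
proof (rule inv_code_inj)
  show "inv_code {} p = inv_code {} q"
    using assms(3) S_length[OF assms(1)] S_length[OF assms(2)] by (intro nth_equalityI) simp_all
qed (use assms(1,2) in \<open>simp_all add: permutations_of_set_def\<close>)

section \<open>Paths and heights through iterates of \<open>bubble\<close>\<close>

lemma id_perm_in_S: "id_perm n \<in> S n"
  by (auto simp: id_perm_def permutations_of_set_def)

lemma inv_code_id_perm_nth:
  assumes "i < n"
  shows "inv_code {} (id_perm n) ! i = 0"
  using assms by (subst inv_code_nth_eq_0_iff) (auto simp: id_perm_def nth_append)

text \<open>Repeating a period of length \<open>h > 0\<close> another \<open>n\<close> times amounts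
  to at least \<open>n\<close> passes, which leave only zeros, the code of the identity.\<close>

lemma bubble_funpow_eq_self:
  assumes "p \<in> S n" "(bubble ^^ h) p = p" "h > 0"
  shows "p = id_perm n"
proof (rule inv_code_eqI)
  fix i assume i: "i < n"
  have "((bubble ^^ h) ^^ n) p = p" using assms(2) by (induction n) auto
  then have p: "(bubble ^^ (h * n)) p = p" by (simp add: funpow_mult)
  have "n \<le> h * n" using assms(3) by simp
  then have "inv_code {} p ! i = 0"
    using inv_code_bubble_funpow_nth[OF assms(1) i, of "h * n"] p \<open>n \<le> h * n\<close> by simp
  then show "inv_code {} p ! i = inv_code {} (id_perm n) ! i"
    using i by (simp add: inv_code_id_perm_nth)
qed (use assms id_perm_in_S in auto)

text \<open>Reaching \<open>p\<close> after two different numbers of passes would make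
  \<open>p\<close> periodic. This is what makes heights well defined.\<close>

lemma bubble_funpow_unique:
  assumes "p \<in> S n" "p \<noteq> id_perm n" "(bubble ^^ h) \<tau> = p" "(bubble ^^ h') \<tau> = p"
  shows "h = h'"
proof -
  have *: False if "a < b" "(bubble ^^ a) \<tau> = p" "(bubble ^^ b) \<tau> = p" for a b
  proof -
    have "(bubble ^^ (b - a)) p = (bubble ^^ (b - a + a)) \<tau>"
      using that by (simp only: funpow_add comp_apply)
    then show False using that bubble_funpow_eq_self[OF assms(1), of "b - a"] assms(2) by simp
  qed
  from *[of h h'] *[of h' h] assms(3,4) show ?thesis by (cases h h' rule: linorder_cases) auto
qed

text \<open>The inequality demanded of each edge is automatic: a fixed point of
  \<open>bubble\<close> with iterate \<open>p\<close> is \<open>p\<close> itself, and then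
  \<open>p\<close> would be the identity.\<close>

lemma tree_edges_relpow:
  assumes "p \<in> S n" "p \<noteq> id_perm n"
  shows "(p, \<tau>) \<in> tree_edges n ^^ h \<longleftrightarrow> \<tau> \<in> S n \<and> (bubble ^^ h) \<tau> = p"
proof (induction h arbitrary: \<tau>)
  case (Suc h)
  have "bubble \<tau> \<noteq> \<tau>" if "(bubble ^^ h) (bubble \<tau>) = p"
  proof
    assume eq: "bubble \<tau> = \<tau>"
    then have "(bubble ^^ h) \<tau> = \<tau>" by (induction h) auto
    with eq that have "(bubble ^^ 1) p = p" by simp
    then show False using bubble_funpow_eq_self[OF assms(1), of 1] assms(2) by simp
  qed
  moreover have "(p, \<tau>) \<in> tree_edges n ^^ Suc h \<longleftrightarrow>
      (\<exists>\<sigma>. (\<sigma> \<in> S n \<and> (bubble ^^ h) \<sigma> = p) \<and> (\<sigma>, \<tau>) \<in> tree_edges n)"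
    by (simp only: relpow.simps relcomp_unfold mem_Collect_eq case_prod_conv Suc.IH)
  moreover have "(bubble ^^ Suc h) \<tau> = (bubble ^^ h) (bubble \<tau>)"
    by (simp only: funpow_Suc_right comp_apply)
  ultimately show ?case
    unfolding tree_edges_def by (auto simp del: funpow.simps)
qed (use assms in auto)

lemma subtree_nodes_iff:
  assumes "p \<in> S n" "p \<noteq> id_perm n"
  shows "\<tau> \<in> subtree_nodes n p \<longleftrightarrow> \<tau> \<in> S n \<and> (\<exists>h. (bubble ^^ h) \<tau> = p)"
  using tree_edges_relpow[OF assms]
  by (auto simp: subtree_nodes_def rtrancl_power)

text \<open>Every vertex on a path from \<open>p\<close> is reachable from \<open>p\<close>, so
  restricting the edges to the subtree loses no such path.\<close>

lemma subtree_edges_relpow: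
  "(p, \<tau>) \<in> subtree_edges n p ^^ h \<longleftrightarrow> (p, \<tau>) \<in> tree_edges n ^^ h"
proof (induction h arbitrary: \<tau>)
  case (Suc h)
  have "(p, \<sigma>) \<in> tree_edges n ^^ h \<Longrightarrow> (\<sigma>, \<tau>) \<in> tree_edges n \<Longrightarrow> (\<sigma>, \<tau>) \<in> subtree_edges n p" for \<sigma>
    using relpow_imp_rtrancl[of "(p, \<sigma>)" h "tree_edges n"]
    by (auto simp: subtree_edges_def subtree_nodes_def intro: rtrancl_into_rtrancl)
  then show ?case using Suc by (auto simp: relcomp_unfold subtree_edges_def)
qed simp

lemma subtree_height_eq:
  assumes "p \<in> S n" "p \<noteq> id_perm n" "\<tau> \<in> S n" "(bubble ^^ h) \<tau> = p"
  shows "subtree_height n p \<tau> = h"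
  unfolding subtree_height_def subtree_edges_relpow tree_edges_relpow[OF assms(1,2)]
  using assms bubble_funpow_unique[OF assms(1,2)] by (intro the_equality) auto

section \<open>Leaves through the last code entry\<close>

lemma ex_bubble_preimage_iff:
  assumes "p \<in> S n" "n > 0"
  shows "(\<exists>\<rho> \<in> S n. bubble \<rho> = p) \<longleftrightarrow> inv_code {} p ! (n - 1) = 0"
proof
  assume "\<exists>\<rho> \<in> S n. bubble \<rho> = p"
  then show "inv_code {} p ! (n - 1) = 0"
    using assms by (auto simp: inv_code_bubble_nth S_length S_distinct)
next
  assume last: "inv_code {} p ! (n - 1) = 0"
  \<comment> \<open>A pass is undone by shifting right and adding 1. The first entry can only be 0;
    the last entry of \<open>p\<close>, lost in the shift, is the 0 that the pass appends.\<close>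
  let ?d = "map (\<lambda>i. if i = 0 then 0 else inv_code {} p ! (i - 1) + 1) [0..<n]"
  have "?d \<in> {c. length c = n \<and> (\<forall>i<n. c ! i \<in> {..i})}"
  proof -
    have "inv_code {} p ! (i - 1) + 1 \<le> i" if "i < n" "0 < i" for i
      using inv_code_nth_le[of "i - 1" p] S_length[OF assms(1)] that by (cases i) simp_all
    then show ?thesis by simp
  qed
  then have "?d \<in> inv_code {} ` S n"
    by (simp only: bij_betw_imp_surj_on[OF inv_code_bij_betw])
  then obtain \<rho> where d: "?d = inv_code {} \<rho>" and \<rho>: "\<rho> \<in> S n"
    by (rule imageE)
  have "bubble \<rho> = p"
  proof (rule inv_code_eqI)
    fix i assume i: "i < n"
    then consider "Suc i < n" | "i = n - 1" by linarith
    then show "inv_code {} (bubble \<rho>) ! i = inv_code {} p ! i"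
      using d[symmetric] i last S_length[OF \<rho>] S_distinct[OF \<rho>]
      by cases (simp_all add: inv_code_bubble_nth)
  qed (use \<rho> assms in simp_all)
  with \<rho> show "\<exists>\<rho> \<in> S n. bubble \<rho> = p" by blast
qed

text \<open>A preimage of a node of the subtree again lies in the subtree and differs from that
  node, so having no child there means having no preimage in \<open>S n\<close>.\<close>

lemma subtree_leaves_iff:
  assumes "p \<in> S n" "p \<noteq> id_perm n"
  shows "\<tau> \<in> subtree_leaves n p \<longleftrightarrow>
    \<tau> \<in> S n \<and> (\<exists>h. (bubble ^^ h) \<tau> = p) \<and> inv_code {} \<tau> ! (n - 1) \<noteq> 0"
proof (cases "\<tau> \<in> subtree_nodes n p")
  case True
  have "n > 0" using assms by (cases n) (auto simp: id_perm_def)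
  have \<tau>: "\<tau> \<in> S n" using True assms subtree_nodes_iff by blast
  obtain h where h: "(p, \<tau>) \<in> tree_edges n ^^ h"
    using True tree_edges_relpow[OF assms] subtree_nodes_iff[OF assms] by blast
  have "(\<tau>, \<rho>) \<in> subtree_edges n p \<longleftrightarrow> \<rho> \<in> S n \<and> bubble \<rho> = \<tau>" for \<rho>
  proof
    assume \<rho>: "\<rho> \<in> S n \<and> bubble \<rho> = \<tau>"
    then have "(bubble ^^ Suc h) \<rho> = p"
      using h tree_edges_relpow[OF assms, of \<tau> h] by (simp add: funpow_swap1)
    then have "(p, \<rho>) \<in> subtree_edges n p ^^ Suc h"
      using \<rho> tree_edges_relpow[OF assms] by (simp only: subtree_edges_relpow)
    then show "(\<tau>, \<rho>) \<in> subtree_edges n p"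
      using \<rho> by (auto simp: subtree_edges_def tree_edges_def relcomp_unfold)
  qed (auto simp: subtree_edges_def tree_edges_def)
  then have "\<tau> \<in> subtree_leaves n p \<longleftrightarrow> \<not> (\<exists>\<rho> \<in> S n. bubble \<rho> = \<tau>)"
    using True by (auto simp: subtree_leaves_def)
  then show ?thesis
    using True subtree_nodes_iff[OF assms] ex_bubble_preimage_iff[OF \<tau> \<open>n > 0\<close>] by auto
next
  case False
  then show ?thesis using subtree_nodes_iff[OF assms] by (auto simp: subtree_leaves_def)
qed

text \<open>Eliminates the \<open>THE\<close> of the height, leaving conditions that translate into
  the code.\<close>

lemma subtree_leaves_height_eq:
  assumes "p \<in> S n" "p \<noteq> id_perm n"
  shows "{\<tau> \<in> subtree_leaves n p. subtree_height n p \<tau> = h}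
    = {\<tau> \<in> S n. (bubble ^^ h) \<tau> = p \<and> inv_code {} \<tau> ! (n - 1) \<noteq> 0}"
  using subtree_height_eq[OF assms] subtree_leaves_iff[OF assms] by auto

section \<open>The label read off the code\<close>

lemma ltr_maxima_nth_iff:
  assumes "distinct p" "j < length p"
  shows "p ! j \<in> ltr_maxima p \<longleftrightarrow> inv_code {} p ! j = 0"
  using assms inv_code_nth_eq_0_iff[OF assms(2,1)]
  by (auto simp: ltr_maxima_def nth_eq_iff_index_eq)

lemma card_ltr_maxima:
  assumes "distinct p"
  shows "card (ltr_maxima p) = card {j. j < length p \<and> inv_code {} p ! j = 0}"
proof -
  have "ltr_maxima p = (!) p ` {j. j < length p \<and> inv_code {} p ! j = 0}"
    using assms by (auto simp: ltr_maxima_def inv_code_nth_eq_0_iff)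
  moreover have "inj_on ((!) p) {j. j < length p \<and> inv_code {} p ! j = 0}"
    using assms by (auto simp: inj_on_def nth_eq_iff_index_eq)
  ultimately show ?thesis by (simp add: card_image)
qed

lemma set_drop_subset_ltr_maxima_iff:
  assumes "distinct p" "l \<le> length p"
  shows "set (drop (length p - l) p) \<subseteq> ltr_maxima p \<longleftrightarrow>
    (\<forall>j. length p - l \<le> j \<and> j < length p \<longrightarrow> inv_code {} p ! j = 0)"
proof -
  have "set (drop (length p - l) p) = (!) p ` {length p - l..<length p}"
    using assms(2) by (metis drop_map drop_upt list.set_map map_nth add_0 set_upt)
  then have "set (drop (length p - l) p) \<subseteq> ltr_maxima p \<longleftrightarrow>
      (\<forall>j. length p - l \<le> j \<and> j < length p \<longrightarrow> p ! j \<in> ltr_maxima p)"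
    by (simp add: image_subset_iff Ball_def)
  then show ?thesis using ltr_maxima_nth_iff[OF assms(1)] by simp
qed

text \<open>A suffix consists of left-to-right maxima exactly when its code entries vanish, so
  \<open>m\<close> is the length of the final run of zeros; maximality makes the entry before that
  run nonzero.\<close>

lemma label_trailing_zeros:
  assumes "distinct p" "label p = (k, m)"
  shows "m \<le> length p"
    and "\<And>j. length p - m \<le> j \<Longrightarrow> j < length p \<Longrightarrow> inv_code {} p ! j = 0"
    and "m < length p \<Longrightarrow> inv_code {} p ! (length p - m - 1) \<noteq> 0"
proof -
  define Q where "Q l \<longleftrightarrow> (\<forall>j. length p - l \<le> j \<and> j < length p \<longrightarrow> inv_code {} p ! j = 0)" for l
  define M where "M = {length s | s. suffix s p \<and> set s \<subseteq> ltr_maxima p}"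
  have M: "M = {l. l \<le> length p \<and> Q l}"
  proof (intro set_eqI iffI)
    fix l assume "l \<in> M"
    then obtain s where s: "l = length s" "suffix s p" "set s \<subseteq> ltr_maxima p"
      unfolding M_def by blast
    then have "l \<le> length p" "drop (length p - l) p = s"
      by (auto simp: suffix_def)
    with s show "l \<in> {l. l \<le> length p \<and> Q l}"
      using set_drop_subset_ltr_maxima_iff[OF assms(1), of l] by (simp add: Q_def)
  next
    fix l assume l: "l \<in> {l. l \<le> length p \<and> Q l}"
    then have "set (drop (length p - l) p) \<subseteq> ltr_maxima p"
      using set_drop_subset_ltr_maxima_iff[OF assms(1), of l] by (simp add: Q_def)
    with l show "l \<in> M"
      unfolding M_def by (intro CollectI exI[of _ "drop (length p - l) p"]) (simp add: suffix_drop)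
  qed
  have fin: "finite M" unfolding M by simp
  have "0 \<in> M" unfolding M Q_def by auto
  have m: "m = Max M" using assms(2) by (simp add: label_def M_def)
  have "m \<in> M" unfolding m using fin \<open>0 \<in> M\<close> by (intro Max_in) auto
  then show "m \<le> length p"
    and zeros: "\<And>j. length p - m \<le> j \<Longrightarrow> j < length p \<Longrightarrow> inv_code {} p ! j = 0"
    unfolding M Q_def by auto
  show "inv_code {} p ! (length p - m - 1) \<noteq> 0" if "m < length p"
  proof
    assume 0: "inv_code {} p ! (length p - m - 1) = 0"
    have "inv_code {} p ! j = 0" if "length p - Suc m \<le> j" "j < length p" for j
      using 0 zeros[of j] that by (cases "j = length p - m - 1") auto
    then have "Suc m \<in> M" using \<open>m < length p\<close> unfolding M Q_def by auto
    then show False using Max_ge[OF fin, of "Suc m"] m by simp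
  qed
qed

section \<open>Counting one level of the tree\<close>

lemma prod_if_eq_power:
  "finite A \<Longrightarrow> (\<Prod>j\<in>A. if P j then a else 1) = (a :: 'a::comm_monoid_mult) ^ card {j \<in> A. P j}"
  by (simp add: prod.If_cases Collect_conj_eq)

text \<open>The entries are chosen independently: the first \<open>h\<close> give
  \<open>fact h\<close>, each later one gives \<open>h + 1\<close> choices over a zero of
  \<open>c\<close> and one choice otherwise. The last entry is kept apart so that \<open>X\<close>
  can later impose being a leaf.\<close>

lemma card_bubble_preimages:
  assumes p: "p \<in> S n" and "h < n" and zeros: "\<And>j. n - h \<le> j \<Longrightarrow> j < n \<Longrightarrow> inv_code {} p ! j = 0"
  defines "c \<equiv> inv_code {} p"
  shows "card {\<tau> \<in> S n. (bubble ^^ h) \<tau> = p \<and> inv_code {} \<tau> ! (n - 1) \<in> X}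
    = fact h * (h + 1) ^ card {j. j < n - h - 1 \<and> c ! j = 0}
      * card ((if c ! (n - h - 1) = 0 then {..h} else {c ! (n - h - 1) + h}) \<inter> X)"
proof -
  \<comment> \<open>\<open>G i\<close> lists the solutions \<open>d\<close> of
    \<open>d - h = c ! (i - h)\<close> for truncated subtraction; the first \<open>h\<close> entries
    are shifted out and only have to respect the range.\<close>
  define G where "G i = (if i < h then {..i} else if c ! (i - h) = 0 then {..h} else {c ! (i - h) + h})"
    for i
  define F where "F i = (if i = n - 1 then G i \<inter> X else G i)" for i
  let ?E = "{d. length d = n \<and> (\<forall>i<n. d ! i \<in> {..i})}"
  let ?L = "{\<tau> \<in> S n. (bubble ^^ h) \<tau> = p \<and> inv_code {} \<tau> ! (n - 1) \<in> X}"
  let ?R = "{d. length d = n \<and> (\<forall>i<n. d ! i \<in> F i)}"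
  have c_le: "c ! i \<le> i" if "i < n" for i
    using that p inv_code_nth_le[of i p] by (simp add: c_def S_length)
  have iff: "(bubble ^^ h) \<tau> = p \<longleftrightarrow> (\<forall>i<n. inv_code {} \<tau> ! i \<in> G i)" if \<tau>: "\<tau> \<in> S n" for \<tau>
  proof -
    have nth: "inv_code {} \<tau> ! i \<le> i" if "i < n" for i
      using that \<tau> inv_code_nth_le[of i \<tau>] by (simp add: S_length)
    have "(bubble ^^ h) \<tau> = p \<longleftrightarrow> (\<forall>i<n. inv_code {} ((bubble ^^ h) \<tau>) ! i = c ! i)"
      using inv_code_eqI[of "(bubble ^^ h) \<tau>" n p] p \<tau> by (auto simp: c_def)
    \<comment> \<open>Where \<open>i + h \<ge> n\<close>, the iterate has an appended 0, which
      agrees with \<open>c\<close> by \<open>zeros\<close>.\<close>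
    also have "\<dots> \<longleftrightarrow> (\<forall>i<n. i + h < n \<longrightarrow> inv_code {} \<tau> ! (i + h) - h = c ! i)"
      using zeros \<tau> by (auto simp: inv_code_bubble_funpow_nth c_def)
    also have "\<dots> \<longleftrightarrow> (\<forall>i<n. h \<le> i \<longrightarrow> inv_code {} \<tau> ! i - h = c ! (i - h))"
      by (metis add_lessD1 diff_add_inverse2 le_add2 le_add_diff_inverse2)
    also have "\<dots> \<longleftrightarrow> (\<forall>i<n. inv_code {} \<tau> ! i \<in> G i)"
      using nth by (auto simp: G_def not_less)
    finally show ?thesis .
  qed
  \<comment> \<open>Each admissible word must be a code for the bijection to count it; for
    \<open>h \<le> i\<close> this follows from \<open>c ! (i - h) + h \<le> i\<close>.\<close>
  have R_sub: "?R \<subseteq> ?E"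
  proof -
    have "G i \<subseteq> {..i}" if "i < n" for i
      using c_le[OF less_imp_diff_less[OF that], of h] by (auto simp: G_def)
    then have "F i \<subseteq> {..i}" if "i < n" for i
      using that by (auto simp: F_def)
    then show ?thesis by blast
  qed
  have "(\<forall>i<n. d ! i \<in> F i) \<longleftrightarrow> (\<forall>i<n. d ! i \<in> G i) \<and> d ! (n - 1) \<in> X" for d
    using \<open>h < n\<close> by (auto simp: F_def)
  then have L: "?L = {\<tau> \<in> S n. inv_code {} \<tau> \<in> ?R}"
    using iff by (auto simp: S_length)
  have "inv_code {} ` {\<tau> \<in> S n. inv_code {} \<tau> \<in> R} = R" if "R \<subseteq> inv_code {} ` S n" for R
    using that by blast
  then have "inv_code {} ` ?L = ?R"
    unfolding L using R_sub by (simp only: bij_betw_imp_surj_on[OF inv_code_bij_betw])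
  moreover have "inj_on (inv_code {}) ?L"
    by (rule inj_on_subset[OF bij_betw_imp_inj_on[OF inv_code_bij_betw]]) (rule Collect_subset)
  ultimately have "card ?L = card ?R" by (simp only: card_image[symmetric])
  also have "\<dots> = (\<Prod>i<n. card (F i))"
    by (rule card_lists_nth_mem) (auto simp: F_def G_def)
  also have "\<dots> = (\<Prod>i<n - 1. card (G i)) * card (G (n - 1) \<inter> X)"
  proof -
    have "{..<n} = insert (n - 1) {..<n - 1}" using \<open>h < n\<close> by auto
    then show ?thesis by (simp add: F_def mult.commute)
  qed
  also have "(\<Prod>i<n - 1. card (G i)) = (\<Prod>i<h. card (G i)) * (\<Prod>j<n - h - 1. card (G (j + h)))"
  proof -
    have "{..<n - 1} = {..<h} \<union> {h..<n - 1}" using \<open>h < n\<close> by auto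
    moreover have "(\<Prod>i\<in>{h..<n - 1}. card (G i)) = (\<Prod>j<n - h - 1. card (G (j + h)))"
      using prod.shift_bounds_nat_ivl[of "\<lambda>i. card (G i)" 0 h "n - h - 1"] \<open>h < n\<close>
      by (simp add: atLeast0LessThan)
    ultimately show ?thesis by (simp add: prod.union_disjoint ivl_disj_int)
  qed
  also have "(\<Prod>i<h. card (G i)) = fact h"
    by (simp add: G_def fact_prod_Suc atLeast0LessThan)
  also have "(\<Prod>j<n - h - 1. card (G (j + h))) = (\<Prod>j<n - h - 1. if c ! j = 0 then h + 1 else 1)"
    by (intro prod.cong) (auto simp: G_def)
  also have "\<dots> = (h + 1) ^ card {j. j < n - h - 1 \<and> c ! j = 0}"
    by (simp only: prod_if_eq_power finite_lessThan lessThan_iff)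
  \<comment> \<open>Since \<open>h < n\<close>, the last position lies beyond the free block and
    corresponds to position \<open>n - h - 1\<close> of \<open>c\<close>.\<close>
  also have "G (n - 1) = (if c ! (n - h - 1) = 0 then {..h} else {c ! (n - h - 1) + h})"
    using \<open>h < n\<close> by (auto simp: G_def diff_right_commute)
  finally show ?thesis .
qed

text \<open>Turns the number of zeros in a prefix, the exponent in the level count, into
  \<open>k\<close> minus the number of trailing zeros cut off.\<close>

lemma card_zeros_split:
  fixes c :: "nat list"
  assumes "l \<le> n" "\<And>j. n - l \<le> j \<Longrightarrow> j < n \<Longrightarrow> c ! j = 0"
  shows "card {j. j < n \<and> c ! j = 0} = card {j. j < n - l \<and> c ! j = 0} + l"
proof -
  have "{j. j < n \<and> c ! j = 0} = {j. j < n - l \<and> c ! j = 0} \<union> {n - l..<n}"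
    using assms(2) by auto
  also have "card \<dots> = card {j. j < n - l \<and> c ! j = 0} + card {n - l..<n}"
    by (intro card_Un_disjoint) auto
  finally show ?thesis using assms(1) by simp
qed

section \<open>Leaves level by level, and their sum\<close>

theorem proposition4p10:
  fixes n k m :: nat and \<pi> :: "nat list"
  assumes "\<pi> \<in> S n"
    and "\<pi> \<noteq> id_perm n"
    and "label \<pi> = (k, m)"
  shows "card (subtree_leaves n \<pi>) =
           (\<Sum>j = 1..m - 1. fact j * j * (j + 1) ^ (k - j - 1)) + fact m * (m + 1) ^ (k - m)
       \<and> (\<forall>j<m. card {\<tau> \<in> subtree_leaves n \<pi>. subtree_height n \<pi> \<tau> = j} =
             fact j * j * (j + 1) ^ (k - j - 1))
       \<and> card {\<tau> \<in> subtree_leaves n \<pi>. subtree_height n \<pi> \<tau> = m} =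
           fact m * (m + 1) ^ (k - m)"
proof -
  define c where "c = inv_code {} \<pi>"
  define H where "H j = {\<tau> \<in> subtree_leaves n \<pi>. subtree_height n \<pi> \<tau> = j}" for j
  have len: "length \<pi> = n" and dist: "distinct \<pi>"
    using assms(1) by (auto simp: S_length S_distinct)
  note label = label_trailing_zeros[OF dist assms(3), unfolded len, folded c_def]
  have zeros: "c ! j = 0" if "n - m \<le> j" "j < n" for j using label(2) that .
  have "m < n"
  proof (rule ccontr)
    assume "\<not> m < n"
    then have "\<pi> = id_perm n"
      using zeros assms(1) id_perm_in_S
      by (intro inv_code_eqI[of _ n]) (auto simp: inv_code_id_perm_nth c_def)
    with assms(2) show False by blast
  qed
  have nz: "c ! (n - m - 1) \<noteq> 0" using label(3) \<open>m < n\<close> .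
  have k: "k = card {j. j < n \<and> c ! j = 0}"
    using assms(3) card_ltr_maxima[OF dist] by (simp add: label_def c_def len)

  have card_H: "card (H h) = fact h * (h + 1) ^ card {j. j < n - h - 1 \<and> c ! j = 0}
      * card ((if c ! (n - h - 1) = 0 then {..h} else {c ! (n - h - 1) + h}) \<inter> - {0})"
    if "h \<le> m" for h
  proof -
    have "H h = {\<tau> \<in> S n. (bubble ^^ h) \<tau> = \<pi> \<and> inv_code {} \<tau> ! (n - 1) \<in> - {0}}"
      unfolding H_def subtree_leaves_height_eq[OF assms(1,2)] by auto
    then show ?thesis
      using card_bubble_preimages[of \<pi> n h "- {0}"] assms(1) that \<open>m < n\<close> zeros
      by (simp add: c_def)
  qed
  have inner: "card (H h) = fact h * h * (h + 1) ^ (k - h - 1)" if "h < m" for h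
  proof -
    \<comment> \<open>For \<open>h < m\<close> position \<open>n - h - 1\<close> is still in the
      final run of zeros. Hence \<open>Suc h\<close> zeros are cut off, and a nonzero last entry has
      the \<open>h\<close> choices \<open>{1..h}\<close>.\<close>
    have "k = card {j. j < n - Suc h \<and> c ! j = 0} + Suc h"
      unfolding k using that \<open>m < n\<close> zeros by (intro card_zeros_split) auto
    then have "card {j. j < n - h - 1 \<and> c ! j = 0} = k - h - 1" by simp
    moreover have "{..h} \<inter> - {0} = {1..h}" by auto
    ultimately show ?thesis
      using card_H[of h] that \<open>m < n\<close> zeros[of "n - h - 1"] by (simp add: mult_ac)
  qed
  have outer: "card (H m) = fact m * (m + 1) ^ (k - m)"
  proof -
    \<comment> \<open>Position \<open>n - m - 1\<close> carries no zero, so only \<open>m\<close>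
      zeros are cut off, and the last entry is forced to a single value, which is positive.\<close>
    have "j < n - m \<and> c ! j = 0 \<longleftrightarrow> j < n - m - 1 \<and> c ! j = 0" for j
      using nz by (cases "j = n - m - 1") auto
    then have "k = card {j. j < n - m - 1 \<and> c ! j = 0} + m"
      using card_zeros_split[of m n c] \<open>m < n\<close> zeros by (simp add: k)
    then show ?thesis using card_H[of m] nz by simp
  qed

  have "subtree_leaves n \<pi> = (\<Union>h\<in>{..m}. H h)"
  proof
    show "subtree_leaves n \<pi> \<subseteq> (\<Union>h\<in>{..m}. H h)"
    proof
      fix \<tau> assume \<tau>: "\<tau> \<in> subtree_leaves n \<pi>"
      then obtain h where h: "\<tau> \<in> S n" "(bubble ^^ h) \<tau> = \<pi>"
        using subtree_leaves_iff[OF assms(1,2)] by blast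
      \<comment> \<open>More than \<open>m\<close> passes would append a 0 that reaches position
        \<open>n - m - 1\<close>, where \<open>c\<close> is nonzero.\<close>
      have "h \<le> m"
      proof (rule ccontr)
        assume "\<not> h \<le> m"
        then have "c ! (n - m - 1) = 0"
          using inv_code_bubble_funpow_nth[OF h(1), of "n - m - 1" h] h(2) \<open>m < n\<close>
          by (simp add: c_def)
        with nz show False by blast
      qed
      with \<tau> h show "\<tau> \<in> (\<Union>h\<in>{..m}. H h)"
        using subtree_height_eq[OF assms(1,2)] by (auto simp: H_def)
    qed
  qed (auto simp: H_def)
  moreover have "finite (H h)" for h
    unfolding H_def subtree_leaves_height_eq[OF assms(1,2)] by simp
  moreover have "H i \<inter> H j = {}" if "i \<noteq> j" for i j
    using that by (auto simp: H_def)
  ultimately have "card (subtree_leaves n \<pi>) = (\<Sum>h\<le>m. card (H h))"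
    by (simp add: card_UN_disjoint)
  also have "\<dots> = (\<Sum>h<m. card (H h)) + card (H m)"
    by (simp flip: lessThan_Suc_atMost)
  also have "(\<Sum>h<m. card (H h)) = (\<Sum>j<m. fact j * j * (j + 1) ^ (k - j - 1))"
    using inner by (intro sum.cong) auto
  \<comment> \<open>The term for \<open>j = 0\<close> vanishes through its factor \<open>j\<close>;
    for \<open>m = 0\<close> both sums are empty.\<close>
  also have "\<dots> = (\<Sum>j = 1..m - 1. fact j * j * (j + 1) ^ (k - j - 1))"
    by (rule sum.mono_neutral_right) auto
  finally show ?thesis using inner outer unfolding H_def by simp
qed

end
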